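(* Let $\textsf{AP}$ be a finite set of atomic propositions containing a proposition $p$. Then $\text{KLTL}\not\leq_{\textit{fin}}\text{HyperCTL}^*$; that is, there exist a finite set of agents $\textsf{Agts}$, a KLTL sentence $\psi$ over $\textsf{Agts}$ and $\textsf{AP}$, and an observation map $\textit{Obs}:\textsf{Agts}\to2^{\textsf{AP}}$ such that for every HyperCTL$^*$ sentence $\varphi$ over $\textsf{AP}$ there is a finite Kripke structure $K$ over $\textsf{AP}$ such that it is not the case that ($K\models\varphi$ iff $(K,\textit{Obs})\models\psi$).
   Context: A Kripke structure over $\textsf{AP}$ is $K=\langle S,s_0,E,V\rangle$ with total transition relation $E\subseteq S\times S$ and valuation $V:S\to2^{\textsf{AP}}$; finite if $S$ is finite; initial paths are infinite $E$-paths from $s_0$. KCTL$^*$: $\varphi::=\top\mid p\mid\neg\varphi\mid\varphi\vee\varphi\mid\textsf{X}\varphi\mid\varphi\textsf{U}\varphi\mid\exists\varphi\mid\textsf{K}_a\varphi$, interpreted on extended structures $(K,\textit{Obs})$ at initial path $\pi$ and position $i$: atoms, Booleans, $\textsf{X}$, $\textsf{U}$ standard; $\exists\varphi$ holds iff some initial $\pi'$ with $\pi'[0,i]=\pi[0,i]$ satisfies $\varphi$ at $i$; $\textsf{K}_a\varphi$ holds iff every initial $\pi'$ with $V(\pi'(j))\cap\textit{Obs}(a)=V(\pi(j))\cap\textit{Obs}(a)$ for all $j\le i$ satisfies $\varphi$ at $i$. $\forall=\neg\exists\neg$, $\textsf{F}\varphi=\top\textsf{U}\varphi$, $\textsf{G}=\neg\textsf{F}\neg$.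 $(K,\textit{Obs})\models\varphi$ iff $\pi,0\models\varphi$ for some initial $\pi$. KLTL is the set of sentences $\forall\varphi$ with $\varphi$ free of path quantifiers. HyperCTL$^*$: $\varphi::=\top\mid p[x]\mid\neg\varphi\mid\varphi\wedge\varphi\mid\textsf{X}\varphi\mid\varphi\textsf{U}\varphi\mid\exists x.\varphi$ with path variables $x$; evaluated at a path assignment $\Pi$ (variables to initial paths), current variable $y$, position $i$: $p[x]$ holds iff $p\in V(\Pi(x)(i))$; $\exists x.\varphi$ holds iff some initial $\pi$ with $\pi[0,i]=\Pi(y)[0,i]$ gives $\Pi[x\leftarrow\pi],x,i\models\varphi$; other cases standard. A sentence has all temporal modalities under a quantifier and all variables bound; $K\models\varphi$ iff $\Pi,y,0\models\varphi$ for some $\Pi,y$. *)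

theory Defs
  imports Main
begin

record ('s, 'p) kripke =
  states :: "'s set"
  init :: 's
  trans :: "('s \<times> 's) set"
  val :: "'s \<Rightarrow> 'p set"

definition kripke_over :: "'p set \<Rightarrow> ('s, 'p) kripke \<Rightarrow> bool" where
  "kripke_over AP K \<longleftrightarrow>
     init K \<in> states K \<and>
     trans K \<subseteq> states K \<times> states K \<and>
     (\<forall>s\<in>states K. \<exists>t. (s, t) \<in> trans K) \<and>
     (\<forall>s\<in>states K. val K s \<subseteq> AP)"

definition finite_kripke :: "('s, 'p) kripke \<Rightarrow> bool" where
  "finite_kripke K \<longleftrightarrow> finite (states K)"

definition initial_path :: "('s, 'p) kripke \<Rightarrow> (nat \<Rightarrow> 's) \<Rightarrow> bool" where
  "initial_path K \<pi> \<longleftrightarrow> \<pi> 0 = init K \<and> (\<forall>i. (\<pi> i, \<pi> (Suc i)) \<in> trans K)"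

definition same_prefix :: "nat \<Rightarrow> (nat \<Rightarrow> 's) \<Rightarrow> (nat \<Rightarrow> 's) \<Rightarrow> bool" where
  "same_prefix i \<pi>' \<pi> \<longleftrightarrow> (\<forall>j\<le>i. \<pi>' j = \<pi> j)"

datatype (kctl_agents: 'a, kctl_props: 'p) kctl =
    KTrue
  | KAtom 'p
  | KNot "('a, 'p) kctl"
  | KOr "('a, 'p) kctl" "('a, 'p) kctl"
  | KNext "('a, 'p) kctl"
  | KUntil "('a, 'p) kctl" "('a, 'p) kctl"
  | KEx "('a, 'p) kctl"
  | Know 'a "('a, 'p) kctl"

abbreviation KAll :: "('a, 'p) kctl \<Rightarrow> ('a, 'p) kctl" where
  "KAll \<phi> \<equiv> KNot (KEx (KNot \<phi>))"

definition obs_equiv ::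
    "('s, 'p) kripke \<Rightarrow> 'p set \<Rightarrow> nat \<Rightarrow> (nat \<Rightarrow> 's) \<Rightarrow> (nat \<Rightarrow> 's) \<Rightarrow> bool" where
  "obs_equiv K A i \<pi>' \<pi> \<longleftrightarrow> (\<forall>j\<le>i. val K (\<pi>' j) \<inter> A = val K (\<pi> j) \<inter> A)"

primrec kctl_sat ::
    "('s, 'p) kripke \<Rightarrow> ('a \<Rightarrow> 'p set) \<Rightarrow> (nat \<Rightarrow> 's) \<Rightarrow> nat \<Rightarrow> ('a, 'p) kctl \<Rightarrow> bool" where
  "kctl_sat K Obs \<pi> i KTrue \<longleftrightarrow> True"
| "kctl_sat K Obs \<pi> i (KAtom p) \<longleftrightarrow> p \<in> val K (\<pi> i)"
| "kctl_sat K Obs \<pi> i (KNot \<phi>) \<longleftrightarrow> \<not> kctl_sat K Obs \<pi> i \<phi>"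
| "kctl_sat K Obs \<pi> i (KOr \<phi> \<psi>) \<longleftrightarrow> kctl_sat K Obs \<pi> i \<phi> \<or> kctl_sat K Obs \<pi> i \<psi>"
| "kctl_sat K Obs \<pi> i (KNext \<phi>) \<longleftrightarrow> kctl_sat K Obs \<pi> (Suc i) \<phi>"
| "kctl_sat K Obs \<pi> i (KUntil \<phi> \<psi>) \<longleftrightarrow>
     (\<exists>j\<ge>i. kctl_sat K Obs \<pi> j \<psi> \<and> (\<forall>k. i \<le> k \<and> k < j \<longrightarrow> kctl_sat K Obs \<pi> k \<phi>))"
| "kctl_sat K Obs \<pi> i (KEx \<phi>) \<longleftrightarrow>
     (\<exists>\<pi>'. initial_path K \<pi>' \<and> same_prefix i \<pi>' \<pi> \<and> kctl_sat K Obs \<pi>' i \<phi>)"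
| "kctl_sat K Obs \<pi> i (Know a \<phi>) \<longleftrightarrow>
     (\<forall>\<pi>'. initial_path K \<pi>' \<and> obs_equiv K (Obs a) i \<pi>' \<pi> \<longrightarrow> kctl_sat K Obs \<pi>' i \<phi>)"

definition kctl_models ::
    "('s, 'p) kripke \<Rightarrow> ('a \<Rightarrow> 'p set) \<Rightarrow> ('a, 'p) kctl \<Rightarrow> bool" where
  "kctl_models K Obs \<phi> \<longleftrightarrow> (\<exists>\<pi>. initial_path K \<pi> \<and> kctl_sat K Obs \<pi> 0 \<phi>)"

definition kctl_over :: "'a set \<Rightarrow> 'p set \<Rightarrow> ('a, 'p) kctl \<Rightarrow> bool" where
  "kctl_over Agts AP \<phi> \<longleftrightarrow> kctl_agents \<phi> \<subseteq> Agts \<and> kctl_props \<phi> \<subseteq> AP"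

primrec path_quantifier_free :: "('a, 'p) kctl \<Rightarrow> bool" where
  "path_quantifier_free KTrue \<longleftrightarrow> True"
| "path_quantifier_free (KAtom p) \<longleftrightarrow> True"
| "path_quantifier_free (KNot \<phi>) \<longleftrightarrow> path_quantifier_free \<phi>"
| "path_quantifier_free (KOr \<phi> \<psi>) \<longleftrightarrow> path_quantifier_free \<phi> \<and> path_quantifier_free \<psi>"
| "path_quantifier_free (KNext \<phi>) \<longleftrightarrow> path_quantifier_free \<phi>"
| "path_quantifier_free (KUntil \<phi> \<psi>) \<longleftrightarrow> path_quantifier_free \<phi> \<and> path_quantifier_free \<psi>"
| "path_quantifier_free (KEx \<phi>) \<longleftrightarrow> False"
| "path_quantifier_free (Know a \<phi>) \<longleftrightarrow> path_quantifier_free \<phi>"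

definition kltl_sentence :: "('a, 'p) kctl \<Rightarrow> bool" where
  "kltl_sentence \<psi> \<longleftrightarrow> (\<exists>\<phi>. path_quantifier_free \<phi> \<and> \<psi> = KAll \<phi>)"

datatype (hctl_props: 'p) hctl =
    HTrue
  | HAtom 'p nat
  | HNot "'p hctl"
  | HAnd "'p hctl" "'p hctl"
  | HNext "'p hctl"
  | HUntil "'p hctl" "'p hctl"
  | HEx nat "'p hctl"

text \<open>The argument \<open>y\<close> is the current path variable: a quantified path has to branch off
  from the path assigned to \<open>y\<close>.\<close>

primrec hctl_sat ::
    "('s, 'p) kripke \<Rightarrow> (nat \<Rightarrow> nat \<Rightarrow> 's) \<Rightarrow> nat \<Rightarrow> nat \<Rightarrow> 'p hctl \<Rightarrow> bool" where
  "hctl_sat K \<Pi> y i HTrue \<longleftrightarrow> True"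
| "hctl_sat K \<Pi> y i (HAtom p x) \<longleftrightarrow> p \<in> val K (\<Pi> x i)"
| "hctl_sat K \<Pi> y i (HNot \<phi>) \<longleftrightarrow> \<not> hctl_sat K \<Pi> y i \<phi>"
| "hctl_sat K \<Pi> y i (HAnd \<phi> \<psi>) \<longleftrightarrow> hctl_sat K \<Pi> y i \<phi> \<and> hctl_sat K \<Pi> y i \<psi>"
| "hctl_sat K \<Pi> y i (HNext \<phi>) \<longleftrightarrow> hctl_sat K \<Pi> y (Suc i) \<phi>"
| "hctl_sat K \<Pi> y i (HUntil \<phi> \<psi>) \<longleftrightarrow>
     (\<exists>j\<ge>i. hctl_sat K \<Pi> y j \<psi> \<and> (\<forall>k. i \<le> k \<and> k < j \<longrightarrow> hctl_sat K \<Pi> y k \<phi>))"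
| "hctl_sat K \<Pi> y i (HEx x \<phi>) \<longleftrightarrow>
     (\<exists>\<pi>. initial_path K \<pi> \<and> same_prefix i \<pi> (\<Pi> y) \<and> hctl_sat K (\<Pi>(x := \<pi>)) x i \<phi>)"

definition hctl_models :: "('s, 'p) kripke \<Rightarrow> 'p hctl \<Rightarrow> bool" where
  "hctl_models K \<phi> \<longleftrightarrow> (\<exists>\<Pi> y. (\<forall>x. initial_path K (\<Pi> x)) \<and> hctl_sat K \<Pi> y 0 \<phi>)"

primrec hctl_free_vars :: "'p hctl \<Rightarrow> nat set" where
  "hctl_free_vars HTrue = {}"
| "hctl_free_vars (HAtom p x) = {x}"
| "hctl_free_vars (HNot \<phi>) = hctl_free_vars \<phi>"
| "hctl_free_vars (HAnd \<phi> \<psi>) = hctl_free_vars \<phi> \<union> hctl_free_vars \<psi>"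
| "hctl_free_vars (HNext \<phi>) = hctl_free_vars \<phi>"
| "hctl_free_vars (HUntil \<phi> \<psi>) = hctl_free_vars \<phi> \<union> hctl_free_vars \<psi>"
| "hctl_free_vars (HEx x \<phi>) = hctl_free_vars \<phi> - {x}"

primrec temporal_guarded :: "'p hctl \<Rightarrow> bool" where
  "temporal_guarded HTrue \<longleftrightarrow> True"
| "temporal_guarded (HAtom p x) \<longleftrightarrow> True"
| "temporal_guarded (HNot \<phi>) \<longleftrightarrow> temporal_guarded \<phi>"
| "temporal_guarded (HAnd \<phi> \<psi>) \<longleftrightarrow> temporal_guarded \<phi> \<and> temporal_guarded \<psi>"
| "temporal_guarded (HNext \<phi>) \<longleftrightarrow> False"
| "temporal_guarded (HUntil \<phi> \<psi>) \<longleftrightarrow> False"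
| "temporal_guarded (HEx x \<phi>) \<longleftrightarrow> True"

definition hctl_sentence_over :: "'p set \<Rightarrow> 'p hctl \<Rightarrow> bool" where
  "hctl_sentence_over AP \<phi> \<longleftrightarrow>
     hctl_props \<phi> \<subseteq> AP \<and> hctl_free_vars \<phi> = {} \<and> temporal_guarded \<phi>"

end

theory Submission
  imports Defs "HOL-Library.Nat_Bijection"
begin

text \<open>
  The separating sentence is \<open>\<forall>F K\<^sub>a \<not>p\<close> for a blind agent \<open>a\<close>: at some position, no
  initial path satisfies \<open>p\<close>. Consider structures whose initial paths are \<open>n\<close> deterministic rows
  that only share the initial state, so that a structure is an \<open>\<omega>\<close>-word of columns, each column
  being the set of rows satisfying \<open>p\<close> there. After position \<open>0\<close>, path quantification is trivial
  and a HyperCTL* formula becomes an LTL formula that mentions fewer than \<open>n\<close> rows.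

  Every LTL subformula, read from right to left along a word, evolves as a bit that is set, cleared
  or kept, depending on the letter and on the truth values of its subformulas. By induction along
  this cascade, for every finite set of LTL formulas there is a finite word \<open>A\<close> over the singleton
  columns such that the formulas do not distinguish \<open>A x A t\<close> from \<open>A t\<close>, for all words \<open>x\<close> over
  the singleton columns and all \<open>\<omega>\<close>-words \<open>t\<close> (\<open>A\<close> lies in the minimal ideal of an aperiodic
  monoid). To a formula ignoring row \<open>j\<close>, the empty column looks like the column \<open>{j}\<close>; hence
  \<open>A {} A t\<close> and \<open>A t\<close> are indistinguishable, although only the former has an empty column when
  \<open>t\<close> repeats the full column.
\<close>

section \<open>LTL on words of sets\<close>

datatype (ltl_atoms: 'a) ltl =
    LFalse
  | LAtom 'a
  | LNot "'a ltl"
  | LAnd "'a ltl" "'a ltl"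
  | LNext "'a ltl"
  | LUntil "'a ltl" "'a ltl"

primrec ltl_sat :: "(nat \<Rightarrow> 'a set) \<Rightarrow> 'a ltl \<Rightarrow> bool" where
  "ltl_sat w LFalse \<longleftrightarrow> False"
| "ltl_sat w (LAtom a) \<longleftrightarrow> a \<in> w 0"
| "ltl_sat w (LNot \<phi>) \<longleftrightarrow> \<not> ltl_sat w \<phi>"
| "ltl_sat w (LAnd \<phi> \<psi>) \<longleftrightarrow> ltl_sat w \<phi> \<and> ltl_sat w \<psi>"
| "ltl_sat w (LNext \<phi>) \<longleftrightarrow> ltl_sat (\<lambda>i. w (Suc i)) \<phi>"
| "ltl_sat w (LUntil \<phi> \<psi>) \<longleftrightarrow>
     (\<exists>j. ltl_sat (\<lambda>i. w (i + j)) \<psi> \<and> (\<forall>k<j. ltl_sat (\<lambda>i. w (i + k)) \<phi>))"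

primrec subltl :: "'a ltl \<Rightarrow> 'a ltl set" where
  "subltl LFalse = {LFalse}"
| "subltl (LAtom a) = {LAtom a}"
| "subltl (LNot \<phi>) = insert (LNot \<phi>) (subltl \<phi>)"
| "subltl (LAnd \<phi> \<psi>) = insert (LAnd \<phi> \<psi>) (subltl \<phi> \<union> subltl \<psi>)"
| "subltl (LNext \<phi>) = insert (LNext \<phi>) (subltl \<phi>)"
| "subltl (LUntil \<phi> \<psi>) = insert (LUntil \<phi> \<psi>) (subltl \<phi> \<union> subltl \<psi>)"

lemma self_in_subltl [simp]: "\<phi> \<in> subltl \<phi>"
  by (cases \<phi>) auto

lemma finite_subltl [simp]: "finite (subltl \<phi>)"
  by (induction \<phi>) auto

primrec ltl_args :: "'a ltl \<Rightarrow> 'a ltl set" where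
  "ltl_args LFalse = {}"
| "ltl_args (LAtom a) = {}"
| "ltl_args (LNot \<phi>) = {\<phi>}"
| "ltl_args (LAnd \<phi> \<psi>) = {\<phi>, \<psi>}"
| "ltl_args (LNext \<phi>) = {\<phi>}"
| "ltl_args (LUntil \<phi> \<psi>) = {\<phi>, \<psi>}"

lemma ltl_args_subltl: "\<psi> \<in> subltl \<phi> \<Longrightarrow> ltl_args \<psi> \<subseteq> subltl \<phi>"
  by (induction \<phi>) auto

lemma ltl_sat_cong_atoms:
  assumes "\<And>i. w i \<inter> ltl_atoms \<phi> = w' i \<inter> ltl_atoms \<phi>"
  shows "ltl_sat w \<phi> \<longleftrightarrow> ltl_sat w' \<phi>"
  using assms
proof (induction \<phi> arbitrary: w w')
  case (LAtom a)
  then show ?case by auto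
next
  case (LNot \<phi>)
  then show ?case by (metis ltl.set(3) ltl_sat.simps(3))
next
  case (LAnd \<phi> \<psi>)
  have "ltl_sat w \<phi> \<longleftrightarrow> ltl_sat w' \<phi>" "ltl_sat w \<psi> \<longleftrightarrow> ltl_sat w' \<psi>"
    using LAnd.prems by (intro LAnd.IH; fastforce)+
  then show ?case by simp
next
  case (LNext \<phi>)
  have "ltl_sat (\<lambda>i. w (Suc i)) \<phi> \<longleftrightarrow> ltl_sat (\<lambda>i. w' (Suc i)) \<phi>"
    using LNext.prems by (intro LNext.IH) simp
  then show ?case by simp
next
  case (LUntil \<phi> \<psi>)
  have "ltl_sat (\<lambda>i. w (i + k)) \<phi> \<longleftrightarrow> ltl_sat (\<lambda>i. w' (i + k)) \<phi>"
    "ltl_sat (\<lambda>i. w (i + k)) \<psi> \<longleftrightarrow> ltl_sat (\<lambda>i. w' (i + k)) \<psi>" for k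
    using LUntil.prems by (intro LUntil.IH; fastforce)+
  then show ?case by simp
qed simp

text \<open>The fixpoint equation shows an until formula to be a one-bit memory updated from right
  to left: the right argument sets it, failure of both arguments clears it, the left argument alone
  keeps it.\<close>

lemma ltl_sat_until_unfold:
  "ltl_sat w (LUntil \<phi> \<psi>) \<longleftrightarrow>
     ltl_sat w \<psi> \<or> ltl_sat w \<phi> \<and> ltl_sat (\<lambda>i. w (Suc i)) (LUntil \<phi> \<psi>)"
  (is "?U \<longleftrightarrow> ?R")
proof
  assume ?U
  then obtain j where j: "ltl_sat (\<lambda>i. w (i + j)) \<psi>" "\<forall>k<j. ltl_sat (\<lambda>i. w (i + k)) \<phi>"
    by auto
  show ?R
  proof (cases j)
    case 0
    then show ?thesis using j by simp
  next
    case (Suc m)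
    have "ltl_sat w \<phi>" using j(2)[rule_format, of 0] Suc by simp
    moreover have "ltl_sat (\<lambda>i. w (Suc (i + k))) \<phi>" if "k < m" for k
      using j(2)[rule_format, of "Suc k"] that Suc by simp
    ultimately show ?thesis using j(1) Suc by auto
  qed
next
  assume ?R
  then show ?U
  proof
    assume "ltl_sat w \<psi>"
    then show ?U by (auto intro!: exI[of _ 0])
  next
    assume r: "ltl_sat w \<phi> \<and> ltl_sat (\<lambda>i. w (Suc i)) (LUntil \<phi> \<psi>)"
    then obtain j where j: "ltl_sat (\<lambda>i. w (Suc (i + j))) \<psi>"
      "\<forall>k<j. ltl_sat (\<lambda>i. w (Suc (i + k))) \<phi>"
      by auto
    have "ltl_sat (\<lambda>i. w (i + k)) \<phi>" if "k < Suc j" for k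
      using that r j(2) by (cases k) auto
    then show ?U using j(1) by (auto intro!: exI[of _ "Suc j"])
  qed
qed

definition conc :: "'b list \<Rightarrow> (nat \<Rightarrow> 'b) \<Rightarrow> nat \<Rightarrow> 'b" (infixr "\<frown>" 65) where
  "u \<frown> t = foldr case_nat u t"

lemma conc_Nil [simp]: "[] \<frown> t = t"
  by (simp add: conc_def)

lemma conc_Cons: "(a # u) \<frown> t = case_nat a (u \<frown> t)"
  by (simp add: conc_def)

lemma conc_append [simp]: "(u @ v) \<frown> t = u \<frown> v \<frown> t"
  by (simp add: conc_def)

lemma conc_const: "length u \<le> i \<Longrightarrow> (u \<frown> (\<lambda>_. c)) i = c"
  by (induction u arbitrary: i) (auto simp: conc_Cons split: nat.split)

lemma range_conc: "range (u \<frown> t) = set u \<union> range t"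
proof (induction u)
  case (Cons a u)
  have "range (case_nat a s) = insert a (range s)" for s :: "nat \<Rightarrow> 'a"
    by (force simp: image_iff split: nat.splits)
  then show ?case using Cons by (simp add: conc_Cons)
qed simp

section \<open>Words that absorb their contexts\<close>

text \<open>For finite \<open>F\<close>, the types are the finitely many states of a deterministic
  automaton that reads words from right to left.\<close>

definition ltl_type :: "'a ltl set \<Rightarrow> (nat \<Rightarrow> 'a set) \<Rightarrow> 'a ltl set" where
  "ltl_type F t = {\<phi>\<in>F. ltl_sat t \<phi>}"

lemma ltl_typeD: "ltl_type F t = ltl_type F t' \<Longrightarrow> \<phi> \<in> F \<Longrightarrow> ltl_sat t \<phi> \<longleftrightarrow> ltl_sat t' \<phi>"
  by (auto simp: ltl_type_def set_eq_iff)

lemma ltl_type_eqI: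
  "(\<And>\<phi>. \<phi> \<in> F \<Longrightarrow> ltl_sat t \<phi> \<longleftrightarrow> ltl_sat t' \<phi>) \<Longrightarrow> ltl_type F t = ltl_type F t'"
  by (auto simp: ltl_type_def)

definition sub_closed :: "'a ltl set \<Rightarrow> bool" where
  "sub_closed F \<longleftrightarrow> (\<forall>\<phi>\<in>F. ltl_args \<phi> \<subseteq> F)"

lemma sub_closed_Union_subltl: "sub_closed (\<Union>(subltl ` F))"
  using ltl_args_subltl by (fastforce simp: sub_closed_def)

text \<open>Closure under arguments makes the type after prepending a letter a function of the
  letter and the old type: a next formula consults the old type, an until formula its arguments now
  and itself in the old type.\<close>

lemma ltl_type_conc_cong:
  assumes "sub_closed F" "ltl_type F t = ltl_type F t'"
  shows "ltl_type F (u \<frown> t) = ltl_type F (u \<frown> t')"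
proof (induction u)
  case (Cons a u)
  have "ltl_sat (case_nat a (u \<frown> t)) \<phi> \<longleftrightarrow> ltl_sat (case_nat a (u \<frown> t')) \<phi>" if "\<phi> \<in> F" for \<phi>
    using that
  proof (induction \<phi>)
    case (LUntil \<phi> \<psi>)
    then have "\<phi> \<in> F" "\<psi> \<in> F" using assms(1) by (force simp: sub_closed_def)+
    then show ?case
      using LUntil ltl_typeD[OF Cons LUntil.prems]
      unfolding ltl_sat_until_unfold[of "case_nat a _"] by simp
  qed (use assms(1) ltl_typeD[OF Cons] in \<open>force simp: sub_closed_def\<close>)+
  then show ?case unfolding conc_Cons by (rule ltl_type_eqI)
qed (use assms in simp)

section \<open>One-bit memories: reset or keep\<close>

text \<open>Meant for a \<open>\<phi>\<close> whose arguments lie in \<open>F\<close> while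
  \<open>\<phi>\<close> itself may not. Setting and clearing are not told apart; all that matters is
  that the old value of \<open>\<phi>\<close> is forgotten.\<close>

definition resets :: "'a ltl set \<Rightarrow> 'a ltl \<Rightarrow> 'a ltl set \<Rightarrow> 'a set list \<Rightarrow> bool" where
  "resets F \<phi> s u \<longleftrightarrow>
     (\<forall>t t'. ltl_type F t = s \<and> ltl_type F t' = s \<longrightarrow>
        (ltl_sat (u \<frown> t) \<phi> \<longleftrightarrow> ltl_sat (u \<frown> t') \<phi>))"

definition keeps :: "'a ltl set \<Rightarrow> 'a ltl \<Rightarrow> 'a ltl set \<Rightarrow> 'a set list \<Rightarrow> bool" where
  "keeps F \<phi> s u \<longleftrightarrow> (\<forall>t. ltl_type F t = s \<longrightarrow> (ltl_sat (u \<frown> t) \<phi> \<longleftrightarrow> ltl_sat t \<phi>))"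

text \<open>Aperiodicity enters here: no letter can flip the bit. Once \<open>s\<close> and
  \<open>a\<close> fix the arguments, an until formula is set, cleared or kept, and any other
  formula has a value determined by \<open>s\<close> and \<open>a\<close>.\<close>

lemma resets_or_keeps_letter:
  assumes F: "sub_closed F" and sub: "ltl_args \<phi> \<subseteq> F"
  shows "resets F \<phi> s [a] \<or> keeps F \<phi> s [a]"
proof -
  have cong: "ltl_sat (case_nat a t) \<psi> \<longleftrightarrow> ltl_sat (case_nat a t') \<psi>"
    if "\<psi> \<in> F" "ltl_type F t = ltl_type F t'" for \<psi> t t'
    using ltl_typeD[OF ltl_type_conc_cong[OF F that(2), of "[a]"] that(1)] by (simp add: conc_Cons)
  show ?thesis
  proof (cases "\<exists>\<psi>\<^sub>1 \<psi>\<^sub>2. \<phi> = LUntil \<psi>\<^sub>1 \<psi>\<^sub>2")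
    case True
    then obtain \<psi>\<^sub>1 \<psi>\<^sub>2 where \<phi>: "\<phi> = LUntil \<psi>\<^sub>1 \<psi>\<^sub>2" by blast
    have in_F: "\<psi>\<^sub>1 \<in> F" "\<psi>\<^sub>2 \<in> F" using sub unfolding \<phi> by simp_all
    have unfold: "ltl_sat ([a] \<frown> t) \<phi> \<longleftrightarrow>
        ltl_sat (case_nat a t) \<psi>\<^sub>2 \<or> ltl_sat (case_nat a t) \<psi>\<^sub>1 \<and> ltl_sat t \<phi>" for t
      unfolding \<phi> conc_Cons conc_Nil by (subst ltl_sat_until_unfold) simp
    show ?thesis
      unfolding resets_def keeps_def unfold
      using cong[OF in_F(1)] cong[OF in_F(2)] by metis
  next
    case False
    have "ltl_sat (case_nat a t) \<phi> \<longleftrightarrow> ltl_sat (case_nat a t') \<phi>"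
      if eq: "ltl_type F t = ltl_type F t'" for t t'
      using False sub by (cases \<phi>) (auto simp: cong[OF _ eq] ltl_typeD[OF eq])
    then show ?thesis by (auto simp: resets_def conc_Cons)
  qed
qed

text \<open>The leftmost letter acts last: if it resets, so does the whole word, and if it keeps,
  the word acts as \<open>u\<close> does. A type \<open>s\<close> that no word realises is reset
  vacuously.\<close>

lemma resets_or_keeps:
  assumes F: "sub_closed F" and sub: "ltl_args \<phi> \<subseteq> F"
  shows "resets F \<phi> s u \<or> keeps F \<phi> s u"
proof (induction u)
  case Nil
  then show ?case by (simp add: keeps_def)
next
  case (Cons a u)
  show ?case
  proof (cases "\<exists>t. ltl_type F t = s")
    case True
    then obtain t\<^sub>0 where "ltl_type F t\<^sub>0 = s" by blast
    then have ty: "ltl_type F (u \<frown> t) = ltl_type F (u \<frown> t\<^sub>0)" if "ltl_type F t = s" for t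
      using ltl_type_conc_cong[OF F] that by metis
    have "resets F \<phi> (ltl_type F (u \<frown> t\<^sub>0)) [a] \<or> keeps F \<phi> (ltl_type F (u \<frown> t\<^sub>0)) [a]"
      by (rule resets_or_keeps_letter[OF F sub])
    moreover have split: "(a # u) \<frown> t = [a] \<frown> u \<frown> t" for t :: "nat \<Rightarrow> 'a set"
      by (simp add: conc_Cons)
    ultimately show ?thesis
      using Cons ty unfolding resets_def keeps_def split by metis
  next
    case False
    then show ?thesis by (auto simp: resets_def)
  qed
qed

section \<open>Construction of absorbing words\<close>

definition absorbing :: "'a set set \<Rightarrow> 'a ltl set \<Rightarrow> 'a set list \<Rightarrow> bool" where
  "absorbing \<Gamma> F A \<longleftrightarrow> A \<in> lists \<Gamma> \<and>
     (\<forall>x\<in>lists \<Gamma>. \<forall>t. ltl_type F (A \<frown> x \<frown> A \<frown> t) = ltl_type F (A \<frown> t))"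

text \<open>In \<open>A B x A B t\<close>, the word \<open>A\<close> absorbs the context
  \<open>B x\<close> for \<open>F\<close>, and \<open>B\<close> absorbs the context
  \<open>x A\<close> for \<open>G\<close>; closure of \<open>G\<close> carries the second equality
  under the leading \<open>A\<close>.\<close>

lemma absorbing_Un:
  assumes A: "absorbing \<Gamma> F A" and B: "absorbing \<Gamma> G B" and G: "sub_closed G"
  shows "absorbing \<Gamma> (F \<union> G) (A @ B)"
  unfolding absorbing_def
proof (intro conjI ballI allI)
  show AB: "A @ B \<in> lists \<Gamma>" using A B by (auto simp: absorbing_def)
  fix x t assume x: "x \<in> lists \<Gamma>"
  have "B @ x \<in> lists \<Gamma>" "x @ A \<in> lists \<Gamma>" using x AB by auto
  then have "ltl_type F (A \<frown> (B @ x) \<frown> A \<frown> B \<frown> t) = ltl_type F (A \<frown> B \<frown> t)"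
    and "ltl_type G (B \<frown> (x @ A) \<frown> B \<frown> t) = ltl_type G (B \<frown> t)"
    using A B unfolding absorbing_def by blast+
  then have "ltl_type F ((A @ B) \<frown> x \<frown> (A @ B) \<frown> t) = ltl_type F ((A @ B) \<frown> t)"
    "ltl_type G ((A @ B) \<frown> x \<frown> (A @ B) \<frown> t) = ltl_type G ((A @ B) \<frown> t)"
    using ltl_type_conc_cong[OF G, of "B \<frown> (x @ A) \<frown> B \<frown> t"] by simp_all
  then show "ltl_type (F \<union> G) ((A @ B) \<frown> x \<frown> (A @ B) \<frown> t) = ltl_type (F \<union> G) ((A @ B) \<frown> t)"
    by (auto simp: ltl_type_def set_eq_iff)
qed

text \<open>Reading \<open>A\<close> leads to a type that no further word \<open>A @ x\<close>
  changes, so there only the bit \<open>\<phi>\<close> can still move. A single \<open>y\<close> is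
  built that resets this bit at every such type where some \<open>A @ x\<close> does; at the
  remaining ones all these words keep it.\<close>

lemma absorbing_insert:
  assumes fin: "finite F" and F: "sub_closed F" and sub: "ltl_args \<phi> \<subseteq> F"
    and A: "absorbing \<Gamma> F A"
  shows "\<exists>A'. absorbing \<Gamma> (insert \<phi> F) A'"
proof -
  have AL: "A \<in> lists \<Gamma>" using A by (simp add: absorbing_def)
  define stable where "stable s \<longleftrightarrow> (\<exists>t. s = ltl_type F (A \<frown> t))" for s
  have loop: "ltl_type F (A \<frown> x \<frown> t) = s"
    if "x \<in> lists \<Gamma>" "stable s" "ltl_type F t = s" for x s t
  proof -
    obtain t' where t': "s = ltl_type F (A \<frown> t')" using \<open>stable s\<close> stable_def by auto
    have "ltl_type F ((A @ x) \<frown> t) = ltl_type F ((A @ x) \<frown> (A \<frown> t'))"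
      by (rule ltl_type_conc_cong[OF F]) (use that t' in simp)
    then show ?thesis using A that(1) t' by (auto simp: absorbing_def)
  qed
  define resettable where
    "resettable s \<longleftrightarrow> (\<exists>x\<in>lists \<Gamma>. resets F \<phi> s (A @ x))" for s
  have "\<exists>y\<in>lists \<Gamma>. (\<forall>s\<in>S. stable s \<longrightarrow> resettable s \<longrightarrow> resets F \<phi> s (A @ y))"
    if "finite S" for S
    using that
  proof (induction S)
    case empty
    then show ?case by (auto intro!: bexI[of _ "[]"])
  next
    case (insert s\<^sub>0 S)
    then obtain y where y: "y \<in> lists \<Gamma>"
      "\<And>s. s \<in> S \<Longrightarrow> stable s \<Longrightarrow> resettable s \<Longrightarrow> resets F \<phi> s (A @ y)"
      by blast
    show ?case
    proof (cases "resettable s\<^sub>0")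
      case False
      then show ?thesis using y by blast
    next
      case True
      then obtain x where x: "x \<in> lists \<Gamma>" "resets F \<phi> s\<^sub>0 (A @ x)"
        unfolding resettable_def by blast
      \<comment> \<open>\<open>A @ y\<close> is read first and preserves the type \<open>s\<close>.
        Then either \<open>A @ x\<close> resets, or it keeps and the reset made by
        \<open>A @ y\<close> survives; in the latter case \<open>s\<close> is not
        \<open>s\<^sub>0\<close>, so the induction hypothesis applies.\<close>
      have "resets F \<phi> s (A @ (x @ A @ y))"
        if s: "s \<in> insert s\<^sub>0 S" "stable s" "resettable s" for s
      proof -
        have ty: "ltl_type F ((A @ y) \<frown> t) = s" if "ltl_type F t = s" for t
          using loop[OF y(1) s(2) that] by simp
        have split: "(A @ (x @ A @ y)) \<frown> t = (A @ x) \<frown> (A @ y) \<frown> t" for t :: "nat \<Rightarrow> 'a set"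
          by simp
        show ?thesis
        proof (cases "resets F \<phi> s (A @ x)")
          case True
          then show ?thesis using ty unfolding resets_def split by blast
        next
          case False
          then have "keeps F \<phi> s (A @ x)" using resets_or_keeps[OF F sub] by blast
          then have "ltl_sat ((A @ x) \<frown> (A @ y) \<frown> t) \<phi> \<longleftrightarrow> ltl_sat ((A @ y) \<frown> t) \<phi>"
            if "ltl_type F t = s" for t
            using ty[OF that] unfolding keeps_def by blast
          note keep = this
          have "resets F \<phi> s (A @ y)" using False x(2) s y(2) by blast
          then have "ltl_sat ((A @ x) \<frown> (A @ y) \<frown> t) \<phi> \<longleftrightarrow> ltl_sat ((A @ x) \<frown> (A @ y) \<frown> t') \<phi>"
            if "ltl_type F t = s" "ltl_type F t' = s" for t t'
            unfolding keep[OF that(1)] keep[OF that(2)] resets_def using that by blast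
          then show ?thesis unfolding resets_def split by blast
        qed
      qed
      moreover have "x @ A @ y \<in> lists \<Gamma>" using x y AL by simp
      ultimately show ?thesis by blast
    qed
  qed
  from this[of "Pow F"] fin obtain y where y: "y \<in> lists \<Gamma>"
    and y_resets: "\<And>s. s \<subseteq> F \<Longrightarrow> stable s \<Longrightarrow> resettable s \<Longrightarrow> resets F \<phi> s (A @ y)"
    by auto
  \<comment> \<open>The right copy of \<open>A\<close> makes the type of any tail stable;
    \<open>A @ y\<close> then resets the bit wherever this is possible.\<close>
  define B where "B = (A @ y) @ A"
  have BL: "B \<in> lists \<Gamma>" using AL y by (simp add: B_def)
  have "ltl_type F (B \<frown> x \<frown> B \<frown> t) = ltl_type F (B \<frown> t)
      \<and> (ltl_sat (B \<frown> x \<frown> B \<frown> t) \<phi> \<longleftrightarrow> ltl_sat (B \<frown> t) \<phi>)"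
    if x: "x \<in> lists \<Gamma>" for x t
  proof -
    define s where "s = ltl_type F (A \<frown> t)"
    have s: "stable s" by (auto simp: stable_def s_def)
    have "s \<subseteq> F" by (auto simp: s_def ltl_type_def)
    have xy: "x @ A @ y \<in> lists \<Gamma>" using x y AL by simp
    have ty1: "ltl_type F (A \<frown> x \<frown> B \<frown> t) = s"
      using loop[OF xy s, of "A \<frown> t"] by (simp add: B_def s_def)
    have ty: "ltl_type F (B \<frown> x \<frown> B \<frown> t) = s" "ltl_type F (B \<frown> t) = s"
      using loop[OF y s ty1] loop[OF y s, of "A \<frown> t"] by (simp_all add: B_def s_def)
    have "ltl_sat (B \<frown> x \<frown> B \<frown> t) \<phi> \<longleftrightarrow> ltl_sat (B \<frown> t) \<phi>"
    proof (cases "resettable s")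
      case True
      then have "resets F \<phi> s (A @ y)" using y_resets \<open>s \<subseteq> F\<close> s by blast
      then have "ltl_sat ((A @ y) \<frown> A \<frown> x \<frown> B \<frown> t) \<phi> \<longleftrightarrow> ltl_sat ((A @ y) \<frown> A \<frown> t) \<phi>"
        using ty1 s_def unfolding resets_def by blast
      then show ?thesis by (simp add: B_def)
    next
      case False
      then have k: "ltl_sat ((A @ z) \<frown> A \<frown> t) \<phi> \<longleftrightarrow> ltl_sat (A \<frown> t) \<phi>" if "z \<in> lists \<Gamma>" for z
        using resets_or_keeps[OF F sub] that s_def unfolding resettable_def keeps_def by blast
      \<comment> \<open>\<open>B x B t\<close> is \<open>A z A t\<close> for this word
        \<open>z\<close>, and \<open>B t\<close> is \<open>A y A t\<close>; both keep the value of
        \<open>\<phi>\<close> at \<open>A t\<close>.\<close>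
      have "y @ A @ x @ A @ y \<in> lists \<Gamma>" using x y AL by simp
      from k[OF this] k[OF y] show ?thesis by (simp add: B_def)
    qed
    then show ?thesis using ty by simp
  qed
  then have "absorbing \<Gamma> (insert \<phi> F) B"
    using BL unfolding absorbing_def by (auto simp: ltl_type_def set_eq_iff)
  then show ?thesis by blast
qed

lemma ex_absorbing_subltl: "\<exists>A. absorbing \<Gamma> (subltl \<phi>) A"
proof (induction \<phi>)
  case LFalse
  have "absorbing \<Gamma> (subltl LFalse) []"
    by (auto simp: absorbing_def ltl_type_def)
  then show ?case by blast
next
  case (LAtom a)
  \<comment> \<open>An atom has no arguments, so it can be inserted over the empty set.\<close>
  have "absorbing \<Gamma> {} []" by (simp add: absorbing_def ltl_type_def)
  from absorbing_insert[OF _ _ _ this, of "LAtom a"] show ?case by (simp add: sub_closed_def)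
next
  case (LNot \<phi>)
  then show ?case
    using absorbing_insert[of "subltl \<phi>" "LNot \<phi>"] sub_closed_Union_subltl[of "{\<phi>}"] by auto
next
  case (LNext \<phi>)
  then show ?case
    using absorbing_insert[of "subltl \<phi>" "LNext \<phi>"] sub_closed_Union_subltl[of "{\<phi>}"] by auto
next
  case (LAnd \<phi> \<psi>)
  then obtain A where "absorbing \<Gamma> (subltl \<phi> \<union> subltl \<psi>) A"
    using absorbing_Un sub_closed_Union_subltl[of "{\<psi>}"] by fastforce
  then show ?case
    using absorbing_insert[of "subltl \<phi> \<union> subltl \<psi>" "LAnd \<phi> \<psi>"]
      sub_closed_Union_subltl[of "{\<phi>, \<psi>}"] by auto
next
  case (LUntil \<phi> \<psi>)
  then obtain A where "absorbing \<Gamma> (subltl \<phi> \<union> subltl \<psi>) A"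
    using absorbing_Un sub_closed_Union_subltl[of "{\<psi>}"] by fastforce
  then show ?case
    using absorbing_insert[of "subltl \<phi> \<union> subltl \<psi>" "LUntil \<phi> \<psi>"]
      sub_closed_Union_subltl[of "{\<phi>, \<psi>}"] by auto
qed

lemma ex_absorbing:
  assumes "finite F"
  shows "\<exists>A. absorbing \<Gamma> (\<Union>(subltl ` F)) A"
  using assms
proof (induction F)
  case empty
  then show ?case by (auto simp: absorbing_def ltl_type_def)
next
  case (insert \<phi> F)
  then show ?case
    using ex_absorbing_subltl[of \<Gamma> \<phi>] absorbing_Un sub_closed_Union_subltl[of F] by fastforce
qed

text \<open>A formula that ignores row \<open>j\<close> cannot tell the hole from the letter
  \<open>{j}\<close>, which \<open>A\<close> absorbs.\<close>

lemma absorbing_hole: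
  fixes n :: nat
  assumes A: "absorbing {{j} |j. j < n} F A" and "\<phi> \<in> F" and j: "j < n" "j \<notin> ltl_atoms \<phi>"
  shows "ltl_sat (A \<frown> [{}] \<frown> A \<frown> t) \<phi> \<longleftrightarrow> ltl_sat (A \<frown> t) \<phi>"
proof -
  have cong: "(u \<frown> s) i \<inter> X = (u \<frown> s') i \<inter> X" if "\<And>i. s i \<inter> X = s' i \<inter> X"
    for u i and X :: "nat set" and s s'
    using that by (induction u arbitrary: i) (auto simp: conc_Cons split: nat.split)
  have "([{}] \<frown> A \<frown> t) i \<inter> ltl_atoms \<phi> = ([{j}] \<frown> A \<frown> t) i \<inter> ltl_atoms \<phi>" for i
    using j(2) by (auto simp: conc_Cons split: nat.split)
  from cong[OF this] have "ltl_sat (A \<frown> [{}] \<frown> A \<frown> t) \<phi> \<longleftrightarrow> ltl_sat (A \<frown> [{j}] \<frown> A \<frown> t) \<phi>"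
    by (rule ltl_sat_cong_atoms)
  also have "\<dots> \<longleftrightarrow> ltl_sat (A \<frown> t) \<phi>"
    using A j(1) \<open>\<phi> \<in> F\<close> by (intro ltl_typeD[of F]) (auto simp: absorbing_def)
  finally show ?thesis .
qed

section \<open>Structures made of rows\<close>

text \<open>Row \<open>j\<close> visits the state coding \<open>(j, i)\<close> at time \<open>i + 1\<close>, until it stays at \<open>(j, L)\<close> forever;
  the columns of \<open>w\<close> are thus shifted by one, behind the shared initial state \<open>0\<close>.\<close>

definition cell :: "nat \<Rightarrow> nat \<Rightarrow> nat" where
  "cell j i = Suc (prod_encode (j, i))"

definition row_kripke :: "'p \<Rightarrow> nat \<Rightarrow> nat \<Rightarrow> (nat \<Rightarrow> nat set) \<Rightarrow> (nat, 'p) kripke" where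
  "row_kripke p n L w =
    \<lparr>states = insert 0 ((\<lambda>(j, i). cell j i) ` ({..<n} \<times> {..L})),
     init = 0,
     trans = {(0, cell j 0) |j. j < n} \<union> {(cell j i, cell j (min (Suc i) L)) |j i. j < n \<and> i \<le> L},
     val = (\<lambda>s. case s of 0 \<Rightarrow> {p} | Suc m \<Rightarrow>
              (case prod_decode m of (j, i) \<Rightarrow> if j \<in> w i then {p} else {}))\<rparr>"

definition row :: "nat \<Rightarrow> nat \<Rightarrow> nat \<Rightarrow> nat" where
  "row L j = case_nat 0 (\<lambda>i. cell j (min i L))"

lemma cell_eq_iff [simp]: "cell j i = cell j' i' \<longleftrightarrow> j = j' \<and> i = i'"
  by (simp add: cell_def)

lemma cell_neq_0 [simp]: "cell j i \<noteq> 0" "0 \<noteq> cell j i"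
  by (simp_all add: cell_def)

lemma row_0 [simp]: "row L j 0 = 0"
  and row_Suc [simp]: "row L j (Suc i) = cell j (min i L)"
  by (simp_all add: row_def)

lemma val_row_kripke [simp]:
  "val (row_kripke p n L w) 0 = {p}"
  "val (row_kripke p n L w) (cell j i) = (if j \<in> w i then {p} else {})"
  by (simp_all add: row_kripke_def cell_def)

lemma kripke_over_row_kripke: "0 < n \<Longrightarrow> p \<in> AP \<Longrightarrow> kripke_over AP (row_kripke p n L w)"
  by (auto simp: kripke_over_def row_kripke_def split: nat.split prod.split)

lemma finite_row_kripke: "finite_kripke (row_kripke p n L w)"
  by (simp add: finite_kripke_def row_kripke_def)

text \<open>Only the initial state branches: the first step chooses the row and everything after it
  is forced.\<close>

lemma initial_path_row_kripke:
  "initial_path (row_kripke p n L w) \<pi> \<longleftrightarrow> (\<exists>j<n. \<pi> = row L j)" (is "?I \<longleftrightarrow> ?R")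
proof
  assume ?I
  then have \<pi>0: "\<pi> 0 = 0" and step: "\<And>i. (\<pi> i, \<pi> (Suc i)) \<in> trans (row_kripke p n L w)"
    by (auto simp: initial_path_def row_kripke_def)
  from step[of 0] \<pi>0 obtain j where j: "j < n" "\<pi> (Suc 0) = cell j 0"
    by (auto simp: row_kripke_def)
  have "\<pi> (Suc i) = cell j (min i L)" for i
  proof (induction i)
    case (Suc i)
    then show ?case using step[of "Suc i"] by (auto simp: row_kripke_def)
  qed (use j in simp)
  then have "\<pi> i = row L j i" for i
    by (cases i) (simp_all add: \<pi>0)
  then show ?R using j(1) by blast
next
  assume ?R
  then obtain j where j: "j < n" "\<pi> = row L j" by blast
  have "(row L j i, row L j (Suc i)) \<in> trans (row_kripke p n L w)" for i
  proof (cases i)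
    case (Suc k)
    have "min (Suc k) L = min (Suc (min k L)) L" by simp
    then show ?thesis using j(1) Suc by (fastforce simp: row_kripke_def)
  qed (use j in \<open>simp add: row_kripke_def\<close>)
  then show ?I using j by (simp add: initial_path_def row_kripke_def)
qed

lemma same_prefix_row: "same_prefix (Suc i) (row L j) (row L j') \<longleftrightarrow> j = j'"
proof
  assume "same_prefix (Suc i) (row L j) (row L j')"
  then have "row L j (Suc i) = row L j' (Suc i)" unfolding same_prefix_def by blast
  then show "j = j'" by simp
qed (simp add: same_prefix_def)

section \<open>HyperCTL* on structures made of rows\<close>

text \<open>A translation for positions after 0, where \<open>f\<close> gives the row of each path
  variable. A quantified path has already left the initial state and can only repeat the row of the
  current variable. Propositions other than \<open>p\<close> label no state.\<close>

primrec rows_ltl :: "'p \<Rightarrow> 'p hctl \<Rightarrow> (nat \<Rightarrow> nat) \<Rightarrow> nat \<Rightarrow> nat ltl" where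
  "rows_ltl p HTrue f y = LNot LFalse"
| "rows_ltl p (HAtom q x) f y = (if q = p then LAtom (f x) else LFalse)"
| "rows_ltl p (HNot \<phi>) f y = LNot (rows_ltl p \<phi> f y)"
| "rows_ltl p (HAnd \<phi> \<psi>) f y = LAnd (rows_ltl p \<phi> f y) (rows_ltl p \<psi> f y)"
| "rows_ltl p (HNext \<phi>) f y = LNext (rows_ltl p \<phi> f y)"
| "rows_ltl p (HUntil \<phi> \<psi>) f y = LUntil (rows_ltl p \<phi> f y) (rows_ltl p \<psi> f y)"
| "rows_ltl p (HEx x \<phi>) f y = rows_ltl p \<phi> (f(x := f y)) x"

primrec hctl_vars :: "'p hctl \<Rightarrow> nat set" where
  "hctl_vars HTrue = {}"
| "hctl_vars (HAtom p x) = {x}"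
| "hctl_vars (HNot \<phi>) = hctl_vars \<phi>"
| "hctl_vars (HAnd \<phi> \<psi>) = hctl_vars \<phi> \<union> hctl_vars \<psi>"
| "hctl_vars (HNext \<phi>) = hctl_vars \<phi>"
| "hctl_vars (HUntil \<phi> \<psi>) = hctl_vars \<phi> \<union> hctl_vars \<psi>"
| "hctl_vars (HEx x \<phi>) = insert x (hctl_vars \<phi>)"

primrec subhctl :: "'p hctl \<Rightarrow> 'p hctl set" where
  "subhctl HTrue = {HTrue}"
| "subhctl (HAtom p x) = {HAtom p x}"
| "subhctl (HNot \<phi>) = insert (HNot \<phi>) (subhctl \<phi>)"
| "subhctl (HAnd \<phi> \<psi>) = insert (HAnd \<phi> \<psi>) (subhctl \<phi> \<union> subhctl \<psi>)"
| "subhctl (HNext \<phi>) = insert (HNext \<phi>) (subhctl \<phi>)"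
| "subhctl (HUntil \<phi> \<psi>) = insert (HUntil \<phi> \<psi>) (subhctl \<phi> \<union> subhctl \<psi>)"
| "subhctl (HEx x \<phi>) = insert (HEx x \<phi>) (subhctl \<phi>)"

lemma self_in_subhctl [simp]: "\<phi> \<in> subhctl \<phi>"
  by (cases \<phi>) auto

lemma finite_subhctl: "finite (subhctl \<phi>)"
  by (induction \<phi>) auto

lemma finite_hctl_vars: "finite (hctl_vars \<phi>)"
  by (induction \<phi>) auto

lemma hctl_vars_subhctl: "\<psi> \<in> subhctl \<phi> \<Longrightarrow> hctl_vars \<psi> \<subseteq> hctl_vars \<phi>"
  by (induction \<phi>) auto

text \<open>The row of \<open>y\<close> must be included because quantifiers copy it to their
  variables.\<close>

lemma ltl_atoms_rows_ltl: "ltl_atoms (rows_ltl p \<phi> f y) \<subseteq> f ` insert y (hctl_vars \<phi>)"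
proof (induction \<phi> arbitrary: f y)
  case (HEx x \<phi>)
  have "(f(x := f y)) ` insert x (hctl_vars \<phi>) \<subseteq> f ` insert y (hctl_vars (HEx x \<phi>))" by auto
  then show ?case using HEx[of "f(x := f y)" x] by (simp only: rows_ltl.simps)
qed (simp; blast)+

text \<open>There are infinitely many \<open>f\<close>, but they enter only through the row numbers
  below \<open>n\<close> at the atoms. Finiteness allows one absorbing word to serve all
  assignments.\<close>

lemma finite_rows_ltl: "finite {rows_ltl p \<phi> f y |f y. range f \<subseteq> {..<n}}"
proof (induction \<phi>)
  case HTrue
  then show ?case by simp
next
  case (HAtom q x)
  have "{rows_ltl p (HAtom q x) f y |f y. range f \<subseteq> {..<n}} \<subseteq> insert LFalse (LAtom ` {..<n})"
    by auto
  then show ?case by (rule finite_subset) simp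
next
  case (HNot \<phi>)
  have "{rows_ltl p (HNot \<phi>) f y |f y. range f \<subseteq> {..<n}}
      \<subseteq> LNot ` {rows_ltl p \<phi> f y |f y. range f \<subseteq> {..<n}}"
    by auto
  then show ?case by (rule finite_subset) (rule finite_imageI[OF HNot])
next
  case (HAnd \<phi> \<psi>)
  have "{rows_ltl p (HAnd \<phi> \<psi>) f y |f y. range f \<subseteq> {..<n}}
      \<subseteq> (\<lambda>(a, b). LAnd a b) ` ({rows_ltl p \<phi> f y |f y. range f \<subseteq> {..<n}}
                                \<times> {rows_ltl p \<psi> f y |f y. range f \<subseteq> {..<n}})"
    by fastforce
  then show ?case by (rule finite_subset) (intro finite_imageI finite_cartesian_product HAnd)
next
  case (HNext \<phi>)
  have "{rows_ltl p (HNext \<phi>) f y |f y. range f \<subseteq> {..<n}}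
      \<subseteq> LNext ` {rows_ltl p \<phi> f y |f y. range f \<subseteq> {..<n}}"
    by auto
  then show ?case by (rule finite_subset) (rule finite_imageI[OF HNext])
next
  case (HUntil \<phi> \<psi>)
  have "{rows_ltl p (HUntil \<phi> \<psi>) f y |f y. range f \<subseteq> {..<n}}
      \<subseteq> (\<lambda>(a, b). LUntil a b) ` ({rows_ltl p \<phi> f y |f y. range f \<subseteq> {..<n}}
                                \<times> {rows_ltl p \<psi> f y |f y. range f \<subseteq> {..<n}})"
    by fastforce
  then show ?case by (rule finite_subset) (intro finite_imageI finite_cartesian_product HUntil)
next
  case (HEx x \<phi>)
  have "range (f(x := f y)) \<subseteq> {..<n}" if "range f \<subseteq> {..<n}" for f :: "nat \<Rightarrow> nat" and y
    using that by auto
  then have "{rows_ltl p (HEx x \<phi>) f y |f y. range f \<subseteq> {..<n}}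
      \<subseteq> {rows_ltl p \<phi> f y |f y. range f \<subseteq> {..<n}}"
    unfolding rows_ltl.simps by blast
  then show ?case by (rule finite_subset) (rule HEx)
qed

lemma ex_ge_until_shift:
  "(\<exists>j\<ge>i. P j \<and> (\<forall>k. i \<le> k \<and> k < j \<longrightarrow> Q k)) \<longleftrightarrow> (\<exists>j. P (i + j) \<and> (\<forall>k<j. Q (i + k)))"
  for i :: nat
proof safe
  fix j assume "i \<le> j" "P j" "\<forall>k. i \<le> k \<and> k < j \<longrightarrow> Q k"
  then show "\<exists>j. P (i + j) \<and> (\<forall>k<j. Q (i + k))" by (intro exI[of _ "j - i"]) auto
next
  fix j assume j: "P (i + j)" "\<forall>k<j. Q (i + k)"
  have "Q k" if "i \<le> k" "k < i + j" for k
    using j(2)[rule_format, of "k - i"] that by simp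
  then show "\<exists>j\<ge>i. P j \<and> (\<forall>k. i \<le> k \<and> k < j \<longrightarrow> Q k)"
    using j(1) by (intro exI[of _ "i + j"]) auto
qed

text \<open>Position \<open>Suc i\<close> shows column \<open>i\<close>, since the initial state
  precedes the columns. Rows stay at column \<open>L\<close>, so \<open>w\<close> has to be constant
  from there on.\<close>

lemma hctl_sat_row_kripke_Suc:
  assumes w: "\<And>i. w (min i L) = w i" and f: "range f \<subseteq> {..<n}"
  shows "hctl_sat (row_kripke p n L w) (\<lambda>x. row L (f x)) y (Suc i) \<phi> \<longleftrightarrow>
    ltl_sat (\<lambda>k. w (k + i)) (rows_ltl p \<phi> f y)"
  using f
proof (induction \<phi> arbitrary: f y i)
  case (HUntil \<phi> \<psi>)
  then show ?case
    unfolding hctl_sat.simps ex_ge_until_shift rows_ltl.simps ltl_sat.simps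
    by (simp add: add.assoc add.commute[of i])
next
  case (HEx x \<phi>)
  have fy: "f y < n" using HEx.prems by auto
  have upd: "(\<lambda>x. row L (f x))(x := row L j) = (\<lambda>z. row L ((f(x := j)) z))" for j
    by auto
  have "range (f(x := f y)) \<subseteq> {..<n}" using HEx.prems by auto
  note IH = HEx.IH[OF this, of x i]
  have "hctl_sat (row_kripke p n L w) (\<lambda>x. row L (f x)) y (Suc i) (HEx x \<phi>) \<longleftrightarrow>
      hctl_sat (row_kripke p n L w) ((\<lambda>x. row L (f x))(x := row L (f y))) x (Suc i) \<phi>"
    using fy by (auto simp: initial_path_row_kripke same_prefix_row)
  also have "\<dots> \<longleftrightarrow> ltl_sat (\<lambda>k. w (k + i)) (rows_ltl p (HEx x \<phi>) f y)"
    using IH by (simp only: upd rows_ltl.simps)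
  finally show ?case .
qed (auto simp: w)

section \<open>Position 0 and the comparison of two row structures\<close>

lemma hctl_sat_until_unfold:
  "hctl_sat K \<Pi> y 0 (HUntil \<phi> \<psi>) \<longleftrightarrow>
     hctl_sat K \<Pi> y 0 \<psi> \<or> hctl_sat K \<Pi> y 0 \<phi> \<and> hctl_sat K \<Pi> y (Suc 0) (HUntil \<phi> \<psi>)"
  (is "?U \<longleftrightarrow> ?R")
proof
  assume ?U
  then obtain j where j: "hctl_sat K \<Pi> y j \<psi>" "\<forall>k<j. hctl_sat K \<Pi> y k \<phi>" by auto
  then show ?R by (cases j) auto
next
  assume ?R
  then show ?U
  proof
    assume r: "hctl_sat K \<Pi> y 0 \<phi> \<and> hctl_sat K \<Pi> y (Suc 0) (HUntil \<phi> \<psi>)"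
    then obtain j where j: "hctl_sat K \<Pi> y j \<psi>" "\<forall>k. Suc 0 \<le> k \<and> k < j \<longrightarrow> hctl_sat K \<Pi> y k \<phi>"
      by auto
    have "hctl_sat K \<Pi> y k \<phi>" if "k < j" for k
      using that r j(2) by (cases k) auto
    then show ?U using j(1) by auto
  qed auto
qed

text \<open>At position 0 a quantifier may pick any of the \<open>n\<close> rows, and the same row
  number answers it in both structures. Temporal operators defer to position 1, where agreement is
  assumed for all subformulas and assignments.\<close>

lemma hctl_sat_row_kripke_0_cong:
  assumes "\<And>\<psi> f y. \<psi> \<in> subhctl \<phi> \<Longrightarrow> range f \<subseteq> {..<n} \<Longrightarrow>
      hctl_sat (row_kripke p n L w) (\<lambda>x. row L (f x)) y (Suc 0) \<psi> \<longleftrightarrow>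
      hctl_sat (row_kripke p n L' w') (\<lambda>x. row L' (f x)) y (Suc 0) \<psi>"
    and "range f \<subseteq> {..<n}"
  shows "hctl_sat (row_kripke p n L w) (\<lambda>x. row L (f x)) y 0 \<phi> \<longleftrightarrow>
      hctl_sat (row_kripke p n L' w') (\<lambda>x. row L' (f x)) y 0 \<phi>"
  using assms
proof (induction \<phi> arbitrary: f y)
  case (HNext \<phi>)
  have "\<phi> \<in> subhctl (HNext \<phi>)" by simp
  from HNext.prems(1)[OF this HNext.prems(2)] show ?case by simp
next
  case (HUntil \<phi> \<psi>)
  have "HUntil \<phi> \<psi> \<in> subhctl (HUntil \<phi> \<psi>)" by simp
  from HUntil.prems(1)[OF this HUntil.prems(2), of y] HUntil.IH HUntil.prems show ?case
    unfolding hctl_sat_until_unfold by (simp del: hctl_sat.simps)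
next
  case (HEx x \<phi>)
  have upd: "(\<lambda>x. row L (f x))(x := row L j) = (\<lambda>z. row L ((f(x := j)) z))" for j L
    by auto
  have ex: "hctl_sat (row_kripke p n L w) (\<lambda>x. row L (f x)) y 0 (HEx x \<phi>) \<longleftrightarrow>
      (\<exists>j<n. hctl_sat (row_kripke p n L w) (\<lambda>z. row L ((f(x := j)) z)) x 0 \<phi>)" for L w
    unfolding upd[symmetric] by (auto simp: initial_path_row_kripke same_prefix_def)
  have "hctl_sat (row_kripke p n L w) (\<lambda>z. row L ((f(x := j)) z)) x 0 \<phi> \<longleftrightarrow>
      hctl_sat (row_kripke p n L' w') (\<lambda>z. row L' ((f(x := j)) z)) x 0 \<phi>" if "j < n" for j
  proof (rule HEx.IH)
    show "range (f(x := j)) \<subseteq> {..<n}" using HEx.prems(2) that by auto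
  qed (use HEx.prems(1) in simp)
  then show ?case unfolding ex by blast
qed simp_all

lemma hctl_models_row_kripke:
  "hctl_models (row_kripke p n L w) \<phi> \<longleftrightarrow>
    (\<exists>f y. range f \<subseteq> {..<n} \<and> hctl_sat (row_kripke p n L w) (\<lambda>x. row L (f x)) y 0 \<phi>)"
  (is "?M \<longleftrightarrow> ?R")
proof
  assume ?M
  then obtain \<Pi> y where \<Pi>: "\<forall>x. \<exists>j<n. \<Pi> x = row L j"
    and sat: "hctl_sat (row_kripke p n L w) \<Pi> y 0 \<phi>"
    by (auto simp: hctl_models_def initial_path_row_kripke)
  from \<Pi> obtain f where f: "\<And>x. f x < n \<and> \<Pi> x = row L (f x)" by metis
  then have "\<Pi> = (\<lambda>x. row L (f x))" by auto
  then show ?R using sat f by blast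
next
  assume ?R
  then obtain f y where "range f \<subseteq> {..<n}"
    and sat: "hctl_sat (row_kripke p n L w) (\<lambda>x. row L (f x)) y 0 \<phi>"
    by blast
  then have "\<forall>x. initial_path (row_kripke p n L w) (row L (f x))"
    by (auto simp: initial_path_row_kripke)
  then show ?M unfolding hctl_models_def using sat by (intro exI conjI)
qed

lemma hctl_models_row_kripke_hole:
  assumes n: "n = Suc (Suc (card (hctl_vars \<phi>)))"
    and F: "F = (\<Union>\<psi>\<in>subhctl \<phi>. {rows_ltl p \<psi> f y |f y. range f \<subseteq> {..<n}})"
    and A: "absorbing {{j} |j. j < n} (\<Union>(subltl ` F)) A"
    and w: "w = A \<frown> (\<lambda>_. c)" "\<And>i. w (min i L) = w i"
    and w': "w' = A \<frown> [{}] \<frown> A \<frown> (\<lambda>_. c)" "\<And>i. w' (min i L') = w' i"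
  shows "hctl_models (row_kripke p n L w) \<phi> \<longleftrightarrow> hctl_models (row_kripke p n L' w') \<phi>"
proof -
  have "hctl_sat (row_kripke p n L w) (\<lambda>x. row L (f x)) y (Suc 0) \<psi> \<longleftrightarrow>
      hctl_sat (row_kripke p n L' w') (\<lambda>x. row L' (f x)) y (Suc 0) \<psi>"
    if \<psi>: "\<psi> \<in> subhctl \<phi>" and f: "range f \<subseteq> {..<n}" for \<psi> f y
  proof -
    \<comment> \<open>The variables of \<open>\<phi>\<close> together with \<open>y\<close> occupy
      at most \<open>n - 1\<close> rows, so some row \<open>j\<close> is invisible to the translated
      formula.\<close>
    have "card (f ` insert y (hctl_vars \<phi>)) \<le> card (insert y (hctl_vars \<phi>))"
      by (intro card_image_le) (simp add: finite_hctl_vars)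
    also have "\<dots> < card {..<n}" using n by (simp add: card_insert_if finite_hctl_vars)
    finally have "\<not> {..<n} \<subseteq> f ` insert y (hctl_vars \<phi>)"
      using card_mono[of "f ` insert y (hctl_vars \<phi>)" "{..<n}"] finite_hctl_vars[of \<phi>]
      by (meson finite.insertI finite_imageI leD)
    then obtain j where "j < n" "j \<notin> f ` insert y (hctl_vars \<phi>)" by auto
    then have j: "j < n" "j \<notin> ltl_atoms (rows_ltl p \<psi> f y)"
      using ltl_atoms_rows_ltl[of p \<psi> f y] hctl_vars_subhctl[OF \<psi>] by auto
    have "rows_ltl p \<psi> f y \<in> F" using \<psi> f F by blast
    then have "rows_ltl p \<psi> f y \<in> \<Union>(subltl ` F)" using self_in_subltl by blast
    from absorbing_hole[OF A this j]
    have "ltl_sat w (rows_ltl p \<psi> f y) \<longleftrightarrow> ltl_sat w' (rows_ltl p \<psi> f y)"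
      unfolding w(1) w'(1) by blast
    then show ?thesis
      by (simp add: hctl_sat_row_kripke_Suc[where w = w, OF w(2) f]
          hctl_sat_row_kripke_Suc[where w = w', OF w'(2) f])
  qed
  from hctl_sat_row_kripke_0_cong[where w = w and w' = w', OF this]
  show ?thesis unfolding hctl_models_row_kripke by (intro ex_cong1 conj_cong refl)
qed

section \<open>The epistemic sentence and the separation\<close>

lemma kctl_models_row_kripke:
  assumes "0 < n" and w: "\<And>i. w (min i L) = w i" "\<And>i. w i \<subseteq> {..<n}"
  shows "kctl_models (row_kripke p n L w) (\<lambda>_. {})
      (KAll (KUntil KTrue (Know a (KNot (KAtom p))))) \<longleftrightarrow> {} \<in> range w"
proof -
  let ?K = "row_kripke p n L w"
  have know: "kctl_sat ?K (\<lambda>_. {}) \<pi> i (Know a (KNot (KAtom p))) \<longleftrightarrow>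
      (\<exists>k. i = Suc k \<and> w k = {})" for \<pi> i
  proof -
    have "kctl_sat ?K (\<lambda>_. {}) \<pi> i (Know a (KNot (KAtom p))) \<longleftrightarrow>
        (\<forall>j<n. p \<notin> val ?K (row L j i))"
      by (auto simp: obs_equiv_def initial_path_row_kripke)
    \<comment> \<open>The blind agent considers all rows possible. Position 0 is excluded because
      the initial state satisfies \<open>p\<close>; at \<open>Suc k\<close>, absence of
      \<open>p\<close> from every row means that column \<open>k\<close>, a subset of the rows, is
      empty.\<close>
    also have "\<dots> \<longleftrightarrow> (\<exists>k. i = Suc k \<and> w k = {})"
      using \<open>0 < n\<close> w(2) by (cases i) (auto simp: w(1))
    finally show ?thesis .
  qed
  have "kctl_sat ?K (\<lambda>_. {}) \<pi> 0 (KUntil KTrue (Know a (KNot (KAtom p)))) \<longleftrightarrow> {} \<in> range w" for \<pi>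
    using know by (auto simp del: kctl_sat.simps(8) simp: image_iff)
  moreover have "initial_path ?K (row L 0)" 
    using \<open>0 < n\<close> by (auto simp: initial_path_row_kripke)
  ultimately show ?thesis
    unfolding kctl_models_def kctl_sat.simps(3,7) same_prefix_def by blast
qed

theorem theorem3:
  fixes AP :: "'p set" and p :: 'p
  assumes "finite AP" and "p \<in> AP"
  shows "\<exists>(Agts :: nat set) (\<psi> :: (nat, 'p) kctl) (Obs :: nat \<Rightarrow> 'p set).
           finite Agts \<and> kltl_sentence \<psi> \<and> kctl_over Agts AP \<psi> \<and> (\<forall>a\<in>Agts. Obs a \<subseteq> AP) \<and>
           (\<forall>\<phi>. hctl_sentence_over AP \<phi> \<longrightarrow>
              (\<exists>K :: (nat, 'p) kripke. kripke_over AP K \<and> finite_kripke K \<and>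
                 \<not> (hctl_models K \<phi> \<longleftrightarrow> kctl_models K Obs \<psi>)))"
proof -
  define \<psi> :: "(nat, 'p) kctl" where "\<psi> = KAll (KUntil KTrue (Know 0 (KNot (KAtom p))))"
  have sep: "\<exists>K :: (nat, 'p) kripke. kripke_over AP K \<and> finite_kripke K \<and>
      \<not> (hctl_models K \<phi> \<longleftrightarrow> kctl_models K (\<lambda>_. {}) \<psi>)" for \<phi> :: "'p hctl"
  proof -
    define n where "n = Suc (Suc (card (hctl_vars \<phi>)))"
    define F where "F = (\<Union>\<psi>\<in>subhctl \<phi>. {rows_ltl p \<psi> f y |f y. range f \<subseteq> {..<n}})"
    have "finite F" unfolding F_def by (intro finite_UN_I finite_subhctl finite_rows_ltl)
    then obtain A where A: "absorbing {{j} |j. j < n} (\<Union>(subltl ` F)) A"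
      using ex_absorbing by blast
    then have set_A: "set A \<subseteq> {{j} |j. j < n}" by (auto simp: absorbing_def)
    define A' where "A' = A @ [{}] @ A"
    \<comment> \<open>The repeated full column is nonempty and \<open>A\<close> consists of
      singletons, so the inserted hole is the only source of an empty column.\<close>
    define w where "w = A \<frown> (\<lambda>_. {..<n})"
    define w' where "w' = A' \<frown> (\<lambda>_. {..<n})"
    define L L' where "L = length A" and "L' = length A'"
    have n: "0 < n" by (simp add: n_def)
    have min: "w (min i L) = w i" "w' (min i L') = w' i" for i
      by (auto simp: w_def w'_def L_def L'_def min_def conc_const)
    have ranges: "range w = insert {..<n} (set A)" "range w' = insert {..<n} (set A')"
      by (auto simp: w_def w'_def range_conc)
    then have sub: "w i \<subseteq> {..<n}" "w' i \<subseteq> {..<n}" for i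
      using set_A rangeI[of w i] rangeI[of w' i] by (auto simp: A'_def)
    have "{} \<notin> range w" "{} \<in> range w'"
      unfolding ranges using set_A n by (auto simp: A'_def)
    then have "\<not> kctl_models (row_kripke p n L w) (\<lambda>_. {}) \<psi>"
      "kctl_models (row_kripke p n L' w') (\<lambda>_. {}) \<psi>"
      unfolding \<psi>_def
      by (simp_all only: kctl_models_row_kripke[where w = w, OF n min(1) sub(1)]
          kctl_models_row_kripke[where w = w', OF n min(2) sub(2)] simp_thms)
    moreover have "hctl_models (row_kripke p n L w) \<phi> \<longleftrightarrow> hctl_models (row_kripke p n L' w') \<phi>"
    proof (rule hctl_models_row_kripke_hole[OF n_def F_def A w_def])
      show "w' = A \<frown> [{}] \<frown> A \<frown> (\<lambda>_. {..<n})" by (simp add: w'_def A'_def conc_Cons)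
    qed (rule min)+
    ultimately have "\<exists>K\<in>{row_kripke p n L w, row_kripke p n L' w'}.
        \<not> (hctl_models K \<phi> \<longleftrightarrow> kctl_models K (\<lambda>_. {}) \<psi>)"
      by simp
    moreover have "kripke_over AP K \<and> finite_kripke K"
      if "K \<in> {row_kripke p n L w, row_kripke p n L' w'}" for K
      using that kripke_over_row_kripke[OF n \<open>p \<in> AP\<close>] finite_row_kripke by fast
    ultimately show ?thesis by meson
  qed
  have "kltl_sentence \<psi>" "kctl_over {0} AP \<psi>"
    using \<open>p \<in> AP\<close> by (simp_all add: \<psi>_def kltl_sentence_def kctl_over_def)
  then show ?thesis
    using sep by (intro exI[of _ "{0}"] exI[of _ \<psi>] exI[of _ "\<lambda>_. {}"]) simp
qed

end
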